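(* Let $p$ be an odd prime, $q\in\mathbb{C}_p$ with $|1-q|_p<p^{-1/(p-1)}$, and $\alpha,\beta,n\in\mathbb{Z}_+$. Then the modified $q$-Genocchi number with weight $(\alpha,\beta)$ satisfies \[ \frac{g^{(\alpha,\beta)}_{n+1,q}}{n+1}=\frac{[2]_{q^{\beta}}}{(1-q^{\alpha})^{n}}\sum_{l=0}^{n}\binom{n}{l}(-1)^{l}\frac{1}{1+q^{\alpha l}}. \]
   Context: $\mathbb{Z}_+=\mathbb{N}\cup\{0\}$, $[x]_q=\frac{1-q^x}{1-q}$. The modified $q$-Genocchi numbers with weight $(\alpha,\beta)$ are defined, for $\alpha,\beta,n\in\mathbb{Z}_+$, by \[ \frac{g^{(\alpha,\beta)}_{n+1,q}}{n+1}=[2]_{q^{\beta}}\sum_{m=0}^{\infty}(-1)^m[m]_{q^{\alpha}}^{n}. \]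
   Formalization: The defining series diverges in C_p and is read as an Euler sum (value at x=1 of the rational function expanding to its generating series); (1-q^α)^n ≠ 0 is assumed, excluding only α=0 or q=1 with n≥1, where the right side is 0/0. *)

theory Defs
  imports
    "HOL-Analysis.Abstract_Metric_Spaces"
    "HOL-Computational_Algebra.Computational_Algebra"
begin

definition padic_abs :: "nat \<Rightarrow> rat \<Rightarrow> real" where
  "padic_abs p r = (if r = 0 then 0 else
     (let (a, b) = quotient_of r
      in real p powi (int (multiplicity (int p) b) - int (multiplicity (int p) a))))"

locale nonarch_valued_field =
  fixes v :: "'a::field_char_0 \<Rightarrow> real"
  assumes v_nonneg: "0 \<le> v x"
    and v_eq_0_iff: "v x = 0 \<longleftrightarrow> x = 0"
    and v_mult: "v (x * y) = v x * v y"
    and v_add_le_max: "v (x + y) \<le> max (v x) (v y)"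
begin

lemma v_zero: "v 0 = 0"
  by (simp add: v_eq_0_iff)

lemma v_one: "v 1 = 1"
  using v_mult[of 1 1] v_eq_0_iff[of 1] by simp

lemma v_minus: "v (- x) = v x"
proof -
  have "v (-1) * v (-1) = 1"
    using v_mult[of "-1" "-1"] by (simp add: v_one)
  hence "v (-1) = 1"
    using v_nonneg[of "-1"] by (metis abs_of_nonneg abs_mult_self_eq mult_eq_0_iff
        power2_eq_1_iff power2_eq_square zero_neq_one neg_0_le_iff_le not_one_le_zero)
  thus ?thesis
    using v_mult[of "-1" x] by simp
qed

lemma v_diff_commute: "v (x - y) = v (y - x)"
  using v_minus[of "x - y"] by simp

lemma v_add_le: "v (x + y) \<le> v x + v y"
  using v_add_le_max[of x y] v_nonneg[of x] v_nonneg[of y] by linarith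

sublocale Metric_space UNIV "\<lambda>x y. v (x - y)"
proof
  show "v (x - z) \<le> v (x - y) + v (y - z)" for x y z
    using v_add_le[of "x - y" "y - z"] by simp
qed (auto simp: v_nonneg v_eq_0_iff intro: v_diff_commute)

definition closure_rat :: "'a set" where
  "closure_rat = mtopology closure_of (range of_rat)"

definition algebraic_elements :: "'a set" where
  "algebraic_elements =
     {x. \<exists>f. f \<noteq> 0 \<and> (\<forall>i. coeff f i \<in> closure_rat) \<and> poly f x = 0}"

end

text \<open>
  The predicate \<open>padic_complex_field p v\<close> says that the field \<open>'a\<close> with absolute value \<open>v\<close> is
  the field of \<open>p\<close>-adic complex numbers, i.e. the completion of an algebraic closure of the
  completion of the rationals under the \<open>p\<close>-adic absolute value. As \<open>'a\<close> is complete, the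
  closure of the rationals in it is the field of \<open>p\<close>-adic numbers. The elements algebraic over
  that subfield form an algebraic closure of it as soon as they are algebraically closed, and \<open>'a\<close>
  is the completion of this algebraic closure because they are dense. This determines
  \<open>'a\<close> and \<open>v\<close> up to isometric isomorphism.
\<close>

locale padic_complex_field = nonarch_valued_field v
  for p :: nat and v :: "'a::field_char_0 \<Rightarrow> real" +
  assumes prime_p: "prime p"
    and v_of_rat: "v (of_rat r) = padic_abs p r"
    and complete: "mcomplete"
    and algebraic_elements_closed:
      "\<lbrakk>\<forall>i. coeff f i \<in> algebraic_elements; degree f > 0\<rbrakk>
        \<Longrightarrow> \<exists>x\<in>algebraic_elements. poly f x = 0"
    and algebraic_elements_dense: "mtopology closure_of algebraic_elements = UNIV"

text \<open>
  The \<open>q\<close>-number \<open>[x]\<^sub>q\<close>, where \<open>[x]\<^sub>1\<close> is the limit \<open>x\<close> as usual. This case matters: it gives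
  \<open>[2]\<^bsub>q^\<beta>\<^esub> = 2\<close> for \<open>\<beta> = 0\<close>.
\<close>

definition q_number :: "'a::field_char_0 \<Rightarrow> nat \<Rightarrow> 'a" where
  "q_number q x = (if q = 1 then of_nat x else (1 - q ^ x) / (1 - q))"

text \<open>
  The terms \<open>(-1)\<^sup>m [m]\<^sup>n\<close> do not tend to \<open>0\<close>, so the series defining the Genocchi numbers has no
  ordinary \<open>p\<close>-adic sum. It is summed in Euler's sense, in which for instance the geometric series
  \<open>\<Sum>\<^sub>m (-c)\<^sup>m\<close> has sum \<open>1 / (1 + c)\<close> whenever \<open>c \<noteq> -1\<close>: the sum of \<open>\<Sum>\<^sub>m a\<^sub>m\<close> is the value at
  \<open>x = 1\<close> of the rational function \<open>P / Q\<close> with power series expansion \<open>\<Sum>\<^sub>m a\<^sub>m x\<^sup>m\<close>. (Letting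
  \<open>x\<close> tend to \<open>1\<close> inside the disc of convergence, as Abel does, is impossible \<open>p\<close>-adically.)
  The two lemmas below show that this sum is unique and agrees with the ordinary one for
  convergent series.
\<close>

definition euler_sums :: "(nat \<Rightarrow> 'a::field_char_0) \<Rightarrow> 'a \<Rightarrow> bool" where
  "euler_sums a s \<longleftrightarrow>
     (\<exists>P Q. poly Q 1 \<noteq> 0 \<and> fps_of_poly Q * Abs_fps a = fps_of_poly P \<and> s = poly P 1 / poly Q 1)"

definition euler_sum :: "(nat \<Rightarrow> 'a::field_char_0) \<Rightarrow> 'a" where
  "euler_sum a = (THE s. euler_sums a s)"

lemma euler_sums_unique:
  assumes "euler_sums a s" "euler_sums a t"
  shows "s = t"
proof -
  obtain P Q where PQ: "poly Q 1 \<noteq> 0" "fps_of_poly Q * Abs_fps a = fps_of_poly P"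
      "s = poly P 1 / poly Q 1"
    using assms(1) by (auto simp: euler_sums_def)
  obtain P' Q' where PQ': "poly Q' 1 \<noteq> 0" "fps_of_poly Q' * Abs_fps a = fps_of_poly P'"
      "t = poly P' 1 / poly Q' 1"
    using assms(2) by (auto simp: euler_sums_def)
  have "fps_of_poly (P * Q') = fps_of_poly (P' * Q)"
    by (simp add: fps_of_poly_mult PQ(2)[symmetric] PQ'(2)[symmetric] mult_ac)
  hence "P * Q' = P' * Q"
    by (simp add: fps_of_poly_eq_iff)
  hence "poly P 1 * poly Q' 1 = poly P' 1 * poly Q 1"
    by (metis poly_mult)
  thus ?thesis
    using PQ(1) PQ'(1) unfolding PQ(3) PQ'(3) by (simp add: frac_eq_eq)
qed

lemma euler_sum_eqI: "euler_sums a s \<Longrightarrow> euler_sum a = s"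
  unfolding euler_sum_def using euler_sums_unique by blast

lemma euler_sums_geometric:
  assumes "c \<noteq> -1"
  shows "euler_sums (\<lambda>m. (-c) ^ m) (1 / (1 + c))"
  unfolding euler_sums_def
proof (intro exI conjI)
  show "poly [:1, c:] 1 \<noteq> 0"
    using assms by (simp add: add_eq_0_iff)
  have "(fps_of_poly [:1, c:] * Abs_fps (\<lambda>m. (-c) ^ m)) $ k = fps_of_poly 1 $ k" for k
    by (cases k) (simp_all add: fps_of_poly_pCons algebra_simps)
  thus "fps_of_poly [:1, c:] * Abs_fps (\<lambda>m. (-c) ^ m) = fps_of_poly 1"
    by (simp add: fps_eq_iff)
qed simp

lemma (in nonarch_valued_field) euler_sums_eq_limit:
  assumes lim: "limitin mtopology (\<lambda>N. \<Sum>m<N. a m) s sequentially"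
    and "euler_sums a t"
  shows "t = s"
proof -
  obtain P Q where PQ: "poly Q 1 \<noteq> 0" "fps_of_poly Q * Abs_fps a = fps_of_poly P"
      "t = poly P 1 / poly Q 1"
    using assms(2) by (auto simp: euler_sums_def)
  define S where "S N = (\<Sum>m\<le>N. a m)" for N
  have v_sum: "v (sum f A) \<le> (\<Sum>i\<in>A. v (f i))" if "finite A" for f :: "nat \<Rightarrow> 'a" and A
    using that
  proof induction
    case (insert x A)
    thus ?case using v_add_le[of "f x" "sum f A"] by simp
  qed (simp add: v_zero)
  have "(\<lambda>N. v ((\<Sum>m<N. a m) - s)) \<longlonglongrightarrow> 0"
    using lim unfolding limitin_metric tendsto_iff
    by (auto simp: v_nonneg)
  hence S_lim: "(\<lambda>N. v (S N - s)) \<longlonglongrightarrow> 0"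
    unfolding S_def lessThan_Suc_atMost[symmetric] by (rule LIMSEQ_Suc)
  have S_fps: "Abs_fps S = Abs_fps a * Abs_fps (\<lambda>_. 1)"
    by (simp add: fps_eq_iff fps_mult_nth S_def atMost_atLeast0)
  have conv: "poly P 1 = (\<Sum>i\<le>degree Q. coeff Q i * S (N - i))"
    if N: "N \<ge> degree P" "N \<ge> degree Q" for N
  proof -
    have "fps_of_poly Q * Abs_fps S = fps_of_poly P * Abs_fps (\<lambda>_. 1)"
      by (simp add: S_fps PQ(2)[symmetric] mult_ac)
    hence "(fps_of_poly Q * Abs_fps S) $ N = (fps_of_poly P * Abs_fps (\<lambda>_. 1)) $ N"
      by simp
    hence "(\<Sum>i=0..N. coeff Q i * S (N - i)) = (\<Sum>i=0..N. coeff P i)"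
      by (simp add: fps_mult_nth)
    also have "\<dots> = (\<Sum>i\<le>degree P. coeff P i)"
      using N by (intro sum.mono_neutral_right) (auto simp: coeff_eq_0)
    also have "\<dots> = poly P 1"
      by (simp add: poly_altdef)
    also have "(\<Sum>i=0..N. coeff Q i * S (N - i)) = (\<Sum>i\<le>degree Q. coeff Q i * S (N - i))"
      using N by (intro sum.mono_neutral_right) (auto simp: coeff_eq_0)
    finally show ?thesis by simp
  qed
  have "(\<lambda>N. \<Sum>i\<le>degree Q. v (coeff Q i) * v (S (N - i) - s)) \<longlonglongrightarrow>
          (\<Sum>i\<le>degree Q. v (coeff Q i) * 0)"
    by (intro tendsto_sum tendsto_mult tendsto_const
        filterlim_compose[OF S_lim filterlim_minus_const_nat_at_top])
  moreover have "\<forall>\<^sub>F N in sequentially. v (poly P 1 - poly Q 1 * s) \<le>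
          (\<Sum>i\<le>degree Q. v (coeff Q i) * v (S (N - i) - s))"
    using eventually_ge_at_top[of "max (degree P) (degree Q)"]
  proof eventually_elim
    case (elim N)
    have "poly P 1 - poly Q 1 * s = (\<Sum>i\<le>degree Q. coeff Q i * (S (N - i) - s))"
      using elim conv[of N]
      by (simp add: poly_altdef sum_distrib_right right_diff_distrib sum_subtractf)
    thus ?case
      using v_sum[of "{..degree Q}" "\<lambda>i. coeff Q i * (S (N - i) - s)"] by (simp add: v_mult)
  qed
  ultimately have "v (poly P 1 - poly Q 1 * s) \<le> 0"
    by (intro tendsto_lowerbound[of _ _ sequentially]) auto
  hence "poly P 1 = poly Q 1 * s"
    using v_nonneg[of "poly P 1 - poly Q 1 * s"] v_eq_0_iff by (metis antisym eq_iff_diff_eq_0)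
  thus ?thesis
    using PQ by simp
qed

text \<open>
  The defining formula fixes \<open>g\<^sub>k\<close> for \<open>k = n + 1\<close>; by the factor \<open>k\<close>, the value at \<open>k = 0\<close> is \<open>0\<close>.
\<close>

definition q_genocchi :: "'a::field_char_0 \<Rightarrow> nat \<Rightarrow> nat \<Rightarrow> nat \<Rightarrow> 'a" where
  "q_genocchi q \<alpha> \<beta> k =
     of_nat k * (q_number (q ^ \<beta>) 2 *
       euler_sum (\<lambda>m. (-1) ^ m * q_number (q ^ \<alpha>) m ^ (k - 1)))"

end

(*
  Expanding (1 - q^(alpha m))^n by the binomial theorem turns the defining series into a linear
  combination of the geometric series of ratio -q^(alpha l). Euler summation is linear, and it sums
  each of these to 1 / (1 + q^(alpha l)). The denominators do not vanish: |1 - q| < 1 gives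
  |1 - q^k| < 1, whereas 1 + q^k = 0 would mean 1 - q^k = 2, which is a p-adic unit for odd p.
*)

theory Submission
  imports Defs
begin

lemma euler_sums_0: "euler_sums (\<lambda>_. 0) 0"
  unfolding euler_sums_def by (intro exI[of _ 0] exI[of _ 1]) (simp add: fps_eq_iff)

text \<open>The two rational functions are added over the common denominator \<open>Q * Q'\<close>,
  which is nonzero at 1 because both factors are.\<close>

lemma euler_sums_add:
  assumes "euler_sums a s" "euler_sums b t"
  shows "euler_sums (\<lambda>m. a m + b m) (s + t)"
proof -
  obtain P Q where PQ: "poly Q 1 \<noteq> 0" "fps_of_poly Q * Abs_fps a = fps_of_poly P"
      "s = poly P 1 / poly Q 1"
    using assms(1) by (auto simp: euler_sums_def)
  obtain P' Q' where PQ': "poly Q' 1 \<noteq> 0" "fps_of_poly Q' * Abs_fps b = fps_of_poly P'"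
      "t = poly P' 1 / poly Q' 1"
    using assms(2) by (auto simp: euler_sums_def)
  have "Abs_fps (\<lambda>m. a m + b m) = Abs_fps a + Abs_fps b"
    by (simp add: fps_eq_iff)
  hence "fps_of_poly (Q * Q') * Abs_fps (\<lambda>m. a m + b m) = fps_of_poly (P * Q' + P' * Q)"
    by (simp add: fps_of_poly_mult fps_of_poly_add PQ(2)[symmetric] PQ'(2)[symmetric] algebra_simps)
  moreover have "s + t = poly (P * Q' + P' * Q) 1 / poly (Q * Q') 1" "poly (Q * Q') 1 \<noteq> 0"
    using PQ(1,3) PQ'(1,3) by (simp_all add: add_frac_eq)
  ultimately show ?thesis
    unfolding euler_sums_def by blast
qed

text \<open>Only the numerator is scaled, so \<open>c = 0\<close> needs no separate case.\<close>

lemma euler_sums_mult_left: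
  assumes "euler_sums a s"
  shows "euler_sums (\<lambda>m. c * a m) (c * s)"
proof -
  obtain P Q where PQ: "poly Q 1 \<noteq> 0" "fps_of_poly Q * Abs_fps a = fps_of_poly P"
      "s = poly P 1 / poly Q 1"
    using assms by (auto simp: euler_sums_def)
  have "Abs_fps (\<lambda>m. c * a m) = fps_const c * Abs_fps a"
    by (simp add: fps_eq_iff)
  hence "fps_of_poly Q * Abs_fps (\<lambda>m. c * a m) = fps_of_poly (smult c P)"
    by (simp add: fps_of_poly_smult PQ(2)[symmetric] mult_ac)
  moreover have "c * s = poly (smult c P) 1 / poly Q 1"
    by (simp add: PQ(3))
  ultimately show ?thesis
    unfolding euler_sums_def using PQ(1) by blast
qed

lemma euler_sums_sum:
  assumes "finite A" "\<And>i. i \<in> A \<Longrightarrow> euler_sums (a i) (s i)"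
  shows "euler_sums (\<lambda>m. \<Sum>i\<in>A. a i m) (\<Sum>i\<in>A. s i)"
  using assms by induction (simp_all add: euler_sums_0 euler_sums_add)

text \<open>Passing from \<open>k\<close> to \<open>Suc k\<close> multiplies
  \<open>1 - q ^ k\<close> by \<open>q\<close>, of absolute value at most 1, and adds
  \<open>1 - q\<close>; the ultrametric inequality keeps the bound.\<close>

lemma (in nonarch_valued_field) v_one_minus_power_le:
  assumes "v (1 - q) \<le> 1"
  shows "v (1 - q ^ k) \<le> v (1 - q)"
proof (induction k)
  case 0
  show ?case by (simp add: v_zero v_nonneg)
next
  case (Suc k)
  \<comment> \<open>Ultrametric inequality for \<open>q = 1 - (1 - q)\<close>.\<close>
  have "v q \<le> 1"
    using v_add_le_max[of 1 "- (1 - q)"] assms unfolding v_minus by (simp add: v_one)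
  hence "v ((1 - q ^ k) * q) \<le> v (1 - q)"
    using Suc mult_mono[of "v (1 - q ^ k)" "v (1 - q)" "v q" 1] by (simp add: v_mult v_nonneg)
  moreover have "1 - q ^ Suc k = (1 - q ^ k) * q + (1 - q)"
    by (simp add: algebra_simps)
  ultimately show ?case
    using v_add_le_max[of "(1 - q ^ k) * q" "1 - q"] by (metis max.bounded_iff max.absorb2)
qed

text \<open>The reduced fraction is \<open>a / 1\<close>, and \<open>p\<close> divides neither part,
  so both multiplicities vanish.\<close>

lemma padic_abs_of_int_eq_1:
  assumes "\<not> int p dvd a"
  shows "padic_abs p (of_int a) = 1"
proof -
  have "a \<noteq> 0" "\<not> is_unit (int p)"
    using assms by (auto intro: dvd_trans)
  thus ?thesis
    using assms by (simp add: padic_abs_def not_dvd_imp_multiplicity_0)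
qed

lemma (in padic_complex_field) one_plus_power_neq_0:
  assumes "odd p" "v (1 - q) < 1"
  shows "1 + q ^ k \<noteq> 0"
proof
  assume "1 + q ^ k = 0"
  hence "q ^ k = -1"
    by (simp add: add_eq_0_iff)
  \<comment> \<open>Writing 2 as the image of a rational integer lets \<open>v_of_rat\<close>
    determine its absolute value.\<close>
  hence "1 - q ^ k = of_rat (of_int 2)"
    by simp
  moreover have "\<not> int p dvd 2"
  proof
    assume "int p dvd 2"
    hence "p dvd 2"
      by presburger
    hence "p = 2"
      using prime_p primes_dvd_imp_eq two_is_prime_nat by blast
    thus False
      using assms(1) by simp
  qed
  ultimately have "v (1 - q ^ k) = 1"
    by (metis v_of_rat padic_abs_of_int_eq_1)
  thus False
    using v_one_minus_power_le[of q k] assms(2) by simp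
qed

text \<open>Here \<open>c\<close> stands for \<open>q ^ \<alpha>\<close>. Requiring
  \<open>(1 - c) ^ n \<noteq> 0\<close> instead of \<open>c \<noteq> 1\<close> keeps the case
  \<open>n = 0\<close>, \<open>c = 1\<close>; the condition on \<open>c ^ l\<close> makes each
  geometric series summable.\<close>

lemma euler_sums_alternating_q_number_power:
  assumes "(1 - c) ^ n \<noteq> 0" "\<And>l. l \<le> n \<Longrightarrow> c ^ l \<noteq> -1"
  shows "euler_sums (\<lambda>m. (-1) ^ m * q_number c m ^ n)
           (1 / (1 - c) ^ n * (\<Sum>l=0..n. of_nat (n choose l) * (-1) ^ l * (1 / (1 + c ^ l))))"
proof -
  \<comment> \<open>For \<open>c = 1\<close>, the hypothesis forces \<open>n = 0\<close>.\<close>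
  have q_number_power: "q_number c m ^ n = 1 / (1 - c) ^ n * (1 - c ^ m) ^ n" for m
    using assms(1) by (cases "n = 0") (auto simp: q_number_def power_divide)
  have binomial: "(-1) ^ m * (1 - c ^ m) ^ n =
      (\<Sum>l=0..n. of_nat (n choose l) * (-1) ^ l * (- (c ^ l)) ^ m)" for m
  proof -
    have "(1 - c ^ m) ^ n = (\<Sum>l=0..n. of_nat (n choose l) * (- (c ^ m)) ^ l)"
      using binomial_ring[of "- (c ^ m)" 1 n] by (simp add: atMost_atLeast0)
    \<comment> \<open>The exponents \<open>m\<close> and \<open>l\<close> trade places: both sides
      have the sign \<open>(-1) ^ (m + l)\<close> and the power \<open>c ^ (m * l)\<close>. Each
      summand is now geometric in \<open>m\<close>.\<close>
    also have "(-1) ^ m * \<dots> = (\<Sum>l=0..n. of_nat (n choose l) * (-1) ^ l * (- (c ^ l)) ^ m)"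
      unfolding sum_distrib_left
      by (intro sum.cong refl)
         (simp add: power_minus[of "c ^ _"] power_mult[symmetric] mult_ac)
    finally show ?thesis .
  qed
  have "(-1) ^ m * q_number c m ^ n =
      1 / (1 - c) ^ n * (\<Sum>l=0..n. of_nat (n choose l) * (-1) ^ l * (- (c ^ l)) ^ m)" for m
    unfolding q_number_power binomial[symmetric] by (simp add: mult_ac)
  moreover have "euler_sums
      (\<lambda>m. 1 / (1 - c) ^ n * (\<Sum>l=0..n. of_nat (n choose l) * (-1) ^ l * (- (c ^ l)) ^ m))
      (1 / (1 - c) ^ n * (\<Sum>l=0..n. of_nat (n choose l) * (-1) ^ l * (1 / (1 + c ^ l))))"
    using assms(2)
    by (intro euler_sums_mult_left euler_sums_sum euler_sums_geometric) auto
  ultimately show ?thesis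
    by simp
qed

theorem theorem1:
  fixes p :: nat and v :: "'a::field_char_0 \<Rightarrow> real" and q :: 'a and \<alpha> \<beta> n :: nat
  assumes "padic_complex_field p v"
    and "prime p" and "odd p"
    and "v (1 - q) < real p powr (- 1 / (real p - 1))"
    and denominator_nonzero: "(1 - q ^ \<alpha>) ^ n \<noteq> 0"
  shows "q_genocchi q \<alpha> \<beta> (n + 1) / of_nat (n + 1) =
         q_number (q ^ \<beta>) 2 / (1 - q ^ \<alpha>) ^ n *
           (\<Sum>l=0..n. of_nat (n choose l) * (-1) ^ l * (1 / (1 + q ^ (\<alpha> * l))))"
proof -
  interpret padic_complex_field p v
    by fact
  have "p > 1"
    using \<open>prime p\<close> by (rule prime_gt_1_nat)
  \<comment> \<open>The exponent is negative, so the given radius is below 1.\<close>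
  hence "real p powr (- 1 / (real p - 1)) < real p powr 0"
    by (intro powr_less_mono) auto
  hence "v (1 - q) < 1"
    using assms(4) \<open>p > 1\<close> by simp
  hence "(q ^ \<alpha>) ^ l \<noteq> -1" for l
    using one_plus_power_neq_0[OF \<open>odd p\<close>, of q "\<alpha> * l"] by (auto simp: power_mult)
  hence "euler_sum (\<lambda>m. (-1) ^ m * q_number (q ^ \<alpha>) m ^ n) = 1 / (1 - q ^ \<alpha>) ^ n *
      (\<Sum>l=0..n. of_nat (n choose l) * (-1) ^ l * (1 / (1 + (q ^ \<alpha>) ^ l)))"
    by (intro euler_sum_eqI euler_sums_alternating_q_number_power denominator_nonzero)
  \<comment> \<open>In characteristic 0 the factor \<open>n + 1\<close> in \<open>q_genocchi\<close>
    cancels; the exponent \<open>k - 1\<close> there is \<open>n\<close>.\<close>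
  moreover have "(of_nat (n + 1) :: 'a) \<noteq> 0"
    by (simp only: of_nat_eq_0_iff)
  ultimately show ?thesis
    by (simp add: q_genocchi_def power_mult del: of_nat_Suc of_nat_add)
qed

end
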